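(* Let $\mathcal{S}_1$ and $\mathcal{S}_2$ be non-empty separated convex sets. The topological space $C(\widetilde{\mathcal{S}}_1,\widetilde{\mathcal{S}}_2)$ (with the modified compact-open topology generated by the sets $O_{K,U}$ with $K$ an essential closed subset of $\widetilde{\mathcal{S}}_1$ and $U$ an essential open subset of $\widetilde{\mathcal{S}}_2$) is Hausdorff; hence so are $\mathcal{A}^c(\widetilde{\mathcal{S}}_1,\widetilde{\mathcal{S}}_2)$ and $\mathcal{A}(\mathcal{S}_1,\mathcal{S}_2)$.
   Context: All vector spaces are real; convex sets are non-empty convex subsets of vector spaces. A convex set $\mathcal{S}$ is separated if for any distinct $s_1,s_2\in\mathcal{S}$ there is an affine functional $f:\mathcal{S}\to\mathbb{R}$ with bounded image and $f(s_1)\ne f(s_2)$. Associated to each separated convex set $\mathcal{S}$ is a collection $(\widetilde{\mathcal{S}},V(\mathcal{S}),\widetilde{V}(\mathcal{S}))$, which is known to exist and to be unique up to isomorphism, with the following properties: $V(\mathcal{S})$ and $\widetilde{V}(\mathcal{S})$ are locally convex Hausdorff topological vector spaces, $V(\mathcal{S})$ being a dense subspace of $\widetilde{V}(\mathcal{S})$; $\mathcal{S}$ is a convex subset of $V(\mathcal{S})$ with affine hull $V(\mathcal{S})$; the topology of $\widetilde{V}(\mathcal{S})$ is the weak topology induced by all continuous linear functionals on $\widetilde{V}(\mathcal{S})$; the topology of $V(\mathcal{S})$ is the weak topology induced by all linear functionals $f$ on $V(\mathcal{S})$ with $f(\mathcal{S})$ bounded; the subspace topology of $\mathcal{S}$ is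 the weak topology induced by all affine functions $\mathcal{S}\to[0,1]$; $\widetilde{\mathcal{S}}$ is the closure of $\mathcal{S}$ in $\widetilde{V}(\mathcal{S})$, and it is convex, compact and complete, with affine hull $\widetilde{V}(\mathcal{S})$. $\mathcal{S}$ and $\widetilde{\mathcal{S}}$ carry these subspace topologies. An open subset $O$ of $\widetilde{\mathcal{S}}$ is essential if $\mathrm{int}_{\widetilde{\mathcal{S}}}(O\cup(\widetilde{\mathcal{S}}\setminus\mathcal{S}))=O$; a closed subset $C$ of $\widetilde{\mathcal{S}}$ is essential if $\mathrm{cl}_{\widetilde{\mathcal{S}}}(C\cap\mathcal{S})=C$ (interior and closure relative to $\widetilde{\mathcal{S}}$). $C(X,Y)$ is the set of continuous maps $X\to Y$. $\mathcal{A}(\mathcal{S}_1,\mathcal{S}_2)$ is the set of all affine maps $\mathcal{S}_1\to\mathcal{S}_2$; $\mathcal{A}^c(\widetilde{\mathcal{S}}_1,\widetilde{\mathcal{S}}_2)$ is the set of all continuous affine maps $\widetilde{\mathcal{S}}_1\to\widetilde{\mathcal{S}}_2$; $\widetilde{\mathcal{A}}(\widetilde{\mathcal{S}}_1,\widetilde{\mathcal{S}}_2)$ is the set of $f\in\mathcal{A}^c(\widetilde{\mathcal{S}}_1,\widetilde{\mathcal{S}}_2)$ with $f(\mathcal{S}_1)\subset\mathcal{S}_2$. Each $f\in\mathcal{A}(\mathcal{S}_1,\mathcal{S}_2)$ extends to a unique $\widetilde{f}\in\widetilde{\mathcal{A}}(\widetilde{\mathcal{S}}_1,\widetilde{\mathcal{S}}_2)$,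 and $f\mapsto\widetilde{f}$ is a bijection $\mathcal{A}(\mathcal{S}_1,\mathcal{S}_2)\to\widetilde{\mathcal{A}}(\widetilde{\mathcal{S}}_1,\widetilde{\mathcal{S}}_2)$. Topology: $C(\widetilde{\mathcal{S}}_1,\widetilde{\mathcal{S}}_2)$ has the topology with subbase consisting of all sets $O_{K,U}=\{f\in C(\widetilde{\mathcal{S}}_1,\widetilde{\mathcal{S}}_2)\mid f(K)\subset U\}$ with $K$ an essential closed subset of $\widetilde{\mathcal{S}}_1$ and $U$ an essential open subset of $\widetilde{\mathcal{S}}_2$. $\mathcal{A}^c(\widetilde{\mathcal{S}}_1,\widetilde{\mathcal{S}}_2)$ and $\widetilde{\mathcal{A}}(\widetilde{\mathcal{S}}_1,\widetilde{\mathcal{S}}_2)$ have the subspace topologies, and $\mathcal{A}(\mathcal{S}_1,\mathcal{S}_2)$ has the topology transferred from $\widetilde{\mathcal{A}}(\widetilde{\mathcal{S}}_1,\widetilde{\mathcal{S}}_2)$ via the bijection $f\mapsto\widetilde{f}$. *)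

theory Defs
  imports "HOL-Analysis.Analysis"
begin

subsection \<open>Affine maps and separated convex sets\<close>

definition affine_map_on :: "'a::real_vector set \<Rightarrow> ('a \<Rightarrow> 'b::real_vector) \<Rightarrow> bool" where
  "affine_map_on S f \<longleftrightarrow>
     (\<forall>x\<in>S. \<forall>y\<in>S. \<forall>u\<in>{0..1}. f ((1 - u) *\<^sub>R x + u *\<^sub>R y) = (1 - u) *\<^sub>R f x + u *\<^sub>R f y)"

definition linear_functional_on :: "'a::real_vector set \<Rightarrow> ('a \<Rightarrow> real) \<Rightarrow> bool" where
  "linear_functional_on V f \<longleftrightarrow>
     (\<forall>x\<in>V. \<forall>y\<in>V. f (x + y) = f x + f y) \<and> (\<forall>x\<in>V. \<forall>c. f (c *\<^sub>R x) = c * f x)"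

definition separated_convex_set :: "'a::real_vector set \<Rightarrow> bool" where
  "separated_convex_set S \<longleftrightarrow>
     S \<noteq> {} \<and> convex S \<and>
     (\<forall>s\<in>S. \<forall>t\<in>S. s \<noteq> t \<longrightarrow>
        (\<exists>f :: 'a \<Rightarrow> real. affine_map_on S f \<and> bounded (f ` S) \<and> f s \<noteq> f t))"


subsection \<open>Topological vector spaces on a carrier\<close>

text \<open>
  A topological vector space is given by a topology \<open>T\<close> whose carrier \<open>topspace T\<close> is a linear
  subspace of an ambient real vector space; the ambient space itself has no topology.
\<close>

definition topological_vector_space :: "'v::real_vector topology \<Rightarrow> bool" where
  "topological_vector_space T \<longleftrightarrow>
     subspace (topspace T) \<and>
     continuous_map (prod_topology T T) T (\<lambda>(x, y). x + y) \<and>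
     continuous_map (prod_topology euclideanreal T) T (\<lambda>(c, x). c *\<^sub>R x)"

definition locally_convex_Hausdorff_tvs :: "'v::real_vector topology \<Rightarrow> bool" where
  "locally_convex_Hausdorff_tvs T \<longleftrightarrow>
     topological_vector_space T \<and> Hausdorff_space T \<and>
     (\<forall>U. openin T U \<and> 0 \<in> U \<longrightarrow> (\<exists>W. openin T W \<and> 0 \<in> W \<and> convex W \<and> W \<subseteq> U))"

text \<open>Completeness refers to the uniformity that the vector space structure induces.\<close>

definition cauchy_filter_in :: "'v::real_vector topology \<Rightarrow> 'v filter \<Rightarrow> bool" where
  "cauchy_filter_in T F \<longleftrightarrow>
     (\<forall>U. openin T U \<and> 0 \<in> U \<longrightarrow>
        (\<exists>A. eventually (\<lambda>x. x \<in> A) F \<and> (\<forall>x\<in>A. \<forall>y\<in>A. x - y \<in> U)))"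

definition complete_in :: "'v::real_vector topology \<Rightarrow> 'v set \<Rightarrow> bool" where
  "complete_in T K \<longleftrightarrow>
     (\<forall>F. F \<noteq> bot \<and> eventually (\<lambda>x. x \<in> K) F \<and> cauchy_filter_in T F \<longrightarrow>
        (\<exists>l\<in>K. limitin T (\<lambda>x. x) l F))"

text \<open>\<open>X\<close> is inserted only so that the carrier is \<open>X\<close> even when the family \<open>\<F>\<close> is empty.\<close>

definition weak_topology :: "'a set \<Rightarrow> ('a \<Rightarrow> real) set \<Rightarrow> 'a topology" where
  "weak_topology X \<F> =
     topology_generated_by (insert X {{x \<in> X. f x \<in> U} | f U. f \<in> \<F> \<and> open U})"


subsection \<open>The compactification of a separated convex set\<close>

text \<open>
  \<open>convex_compactification S \<iota> T\<close> lists the properties that determine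
  \<open>(S~, V(S), V~(S))\<close> up to isomorphism. Here \<open>\<iota>\<close> is the affine embedding identifying \<open>S\<close> with
  a subset of \<open>V(S)\<close>, \<open>T\<close> is the topology of \<open>V~(S)\<close>, the space \<open>V~(S)\<close> is \<open>topspace T\<close>, the
  space \<open>V(S)\<close> is the affine hull of \<open>\<iota> ` S\<close>, and \<open>S~\<close> is the closure of \<open>\<iota> ` S\<close>.
\<close>

locale convex_compactification =
  fixes S :: "'a::real_vector set"
    and \<iota> :: "'a \<Rightarrow> 'v::real_vector"
    and T :: "'v topology"
  assumes embedding_affine: "affine_map_on S \<iota>"
    and embedding_inj: "inj_on \<iota> S"
    and tvs_big: "locally_convex_Hausdorff_tvs T"
    and tvs_small: "locally_convex_Hausdorff_tvs (subtopology T (affine hull (\<iota> ` S)))"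
    and small_subspace: "subspace (affine hull (\<iota> ` S))"
    and small_subset: "affine hull (\<iota> ` S) \<subseteq> topspace T"
    and small_dense: "T closure_of (affine hull (\<iota> ` S)) = topspace T"
    and big_topology:
      "T = weak_topology (topspace T)
             {f. linear_functional_on (topspace T) f \<and> continuous_map T euclideanreal f}"
    and small_topology:
      "subtopology T (affine hull (\<iota> ` S)) =
         weak_topology (affine hull (\<iota> ` S))
           {f. linear_functional_on (affine hull (\<iota> ` S)) f \<and> bounded (f ` \<iota> ` S)}"
    and set_topology:
      "subtopology T (\<iota> ` S) =
         weak_topology (\<iota> ` S) {f. affine_map_on (\<iota> ` S) f \<and> f ` \<iota> ` S \<subseteq> {0..1}}"
    and closure_convex: "convex (T closure_of (\<iota> ` S))"
    and closure_compact: "compactin T (T closure_of (\<iota> ` S))"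
    and closure_complete: "complete_in T (T closure_of (\<iota> ` S))"
    and closure_hull: "affine hull (T closure_of (\<iota> ` S)) = topspace T"

definition ctop :: "'a set \<Rightarrow> ('a \<Rightarrow> 'v) \<Rightarrow> 'v topology \<Rightarrow> 'v topology" where
  "ctop S \<iota> T = subtopology T (T closure_of (\<iota> ` S))"


subsection \<open>Essential sets and the modified compact-open topology\<close>

text \<open>In this section \<open>X\<close> is the space \<open>S~\<close> and \<open>D\<close> is its distinguished dense subset \<open>S\<close>.\<close>

definition essential_open :: "'v topology \<Rightarrow> 'v set \<Rightarrow> 'v set \<Rightarrow> bool" where
  "essential_open X D U \<longleftrightarrow> openin X U \<and> X interior_of (U \<union> (topspace X - D)) = U"

definition essential_closed :: "'v topology \<Rightarrow> 'v set \<Rightarrow> 'v set \<Rightarrow> bool" where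
  "essential_closed X D K \<longleftrightarrow> closedin X K \<and> X closure_of (K \<inter> D) = K"

text \<open>
  Maps defined on a set are represented by functions that are \<open>undefined\<close> outside it, so that
  equality of functions is equality of maps.
\<close>

definition cmaps :: "'v topology \<Rightarrow> 'w topology \<Rightarrow> ('v \<Rightarrow> 'w) set" where
  "cmaps X Y = {f \<in> extensional (topspace X). continuous_map X Y f}"

definition cmaps_topology ::
  "'v topology \<Rightarrow> 'v set \<Rightarrow> 'w topology \<Rightarrow> 'w set \<Rightarrow> ('v \<Rightarrow> 'w) topology" where
  "cmaps_topology X D Y E =
     topology_generated_by
       {{f \<in> cmaps X Y. f ` K \<subseteq> U} | K U. essential_closed X D K \<and> essential_open Y E U}"

lemma topspace_cmaps_topology [simp]: "topspace (cmaps_topology X D Y E) = cmaps X Y"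
proof -
  have "essential_closed X D {}" "essential_open Y E (topspace Y)"
    by (auto simp: essential_closed_def essential_open_def Un_absorb2)
  then have "{f \<in> cmaps X Y. f ` {} \<subseteq> topspace Y} \<in>
      {{f \<in> cmaps X Y. f ` K \<subseteq> U} | K U. essential_closed X D K \<and> essential_open Y E U}"
    by blast
  then show ?thesis
    unfolding cmaps_topology_def topology_generated_by_topspace by auto
qed


subsection \<open>Spaces of affine maps\<close>

definition affine_maps :: "'a::real_vector set \<Rightarrow> 'b::real_vector set \<Rightarrow> ('a \<Rightarrow> 'b) set" where
  "affine_maps S\<^sub>1 S\<^sub>2 = {f \<in> S\<^sub>1 \<rightarrow>\<^sub>E S\<^sub>2. affine_map_on S\<^sub>1 f}"

definition continuous_affine_maps ::
  "'v::real_vector topology \<Rightarrow> 'w::real_vector topology \<Rightarrow> ('v \<Rightarrow> 'w) set" where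
  "continuous_affine_maps X Y = {f \<in> cmaps X Y. affine_map_on (topspace X) f}"

definition continuous_affine_maps_topology ::
  "'v::real_vector topology \<Rightarrow> 'v set \<Rightarrow> 'w::real_vector topology \<Rightarrow> 'w set \<Rightarrow> ('v \<Rightarrow> 'w) topology"
  where
  "continuous_affine_maps_topology X D Y E =
     subtopology (cmaps_topology X D Y E) (continuous_affine_maps X Y)"

definition preserving_affine_maps ::
  "'v::real_vector topology \<Rightarrow> 'v set \<Rightarrow> 'w::real_vector topology \<Rightarrow> 'w set \<Rightarrow> ('v \<Rightarrow> 'w) set" where
  "preserving_affine_maps X D Y E = {f \<in> continuous_affine_maps X Y. f ` D \<subseteq> E}"

definition preserving_affine_maps_topology ::
  "'v::real_vector topology \<Rightarrow> 'v set \<Rightarrow> 'w::real_vector topology \<Rightarrow> 'w set \<Rightarrow> ('v \<Rightarrow> 'w) topology"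
  where
  "preserving_affine_maps_topology X D Y E =
     subtopology (cmaps_topology X D Y E) (preserving_affine_maps X D Y E)"

text \<open>The map \<open>f \<mapsto> f~\<close>; modulo the embeddings, \<open>f~\<close> restricts to \<open>f\<close>.\<close>

definition affine_extension ::
  "'a::real_vector set \<Rightarrow> ('a \<Rightarrow> 'v::real_vector) \<Rightarrow> 'v topology \<Rightarrow>
   'b::real_vector set \<Rightarrow> ('b \<Rightarrow> 'w::real_vector) \<Rightarrow> 'w topology \<Rightarrow> ('a \<Rightarrow> 'b) \<Rightarrow> 'v \<Rightarrow> 'w" where
  "affine_extension S\<^sub>1 \<iota>\<^sub>1 T\<^sub>1 S\<^sub>2 \<iota>\<^sub>2 T\<^sub>2 f =
     (THE g. g \<in> preserving_affine_maps (ctop S\<^sub>1 \<iota>\<^sub>1 T\<^sub>1) (\<iota>\<^sub>1 ` S\<^sub>1) (ctop S\<^sub>2 \<iota>\<^sub>2 T\<^sub>2) (\<iota>\<^sub>2 ` S\<^sub>2) \<and>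
             (\<forall>s\<in>S\<^sub>1. g (\<iota>\<^sub>1 s) = \<iota>\<^sub>2 (f s)))"

definition affine_maps_topology ::
  "'a::real_vector set \<Rightarrow> ('a \<Rightarrow> 'v::real_vector) \<Rightarrow> 'v topology \<Rightarrow>
   'b::real_vector set \<Rightarrow> ('b \<Rightarrow> 'w::real_vector) \<Rightarrow> 'w topology \<Rightarrow> ('a \<Rightarrow> 'b) topology" where
  "affine_maps_topology S\<^sub>1 \<iota>\<^sub>1 T\<^sub>1 S\<^sub>2 \<iota>\<^sub>2 T\<^sub>2 =
     pullback_topology (affine_maps S\<^sub>1 S\<^sub>2) (affine_extension S\<^sub>1 \<iota>\<^sub>1 T\<^sub>1 S\<^sub>2 \<iota>\<^sub>2 T\<^sub>2)
       (preserving_affine_maps_topology (ctop S\<^sub>1 \<iota>\<^sub>1 T\<^sub>1) (\<iota>\<^sub>1 ` S\<^sub>1) (ctop S\<^sub>2 \<iota>\<^sub>2 T\<^sub>2) (\<iota>\<^sub>2 ` S\<^sub>2))"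

end

theory Submission
  imports Defs
begin

text \<open>
  Since \<open>S~\<close> is Hausdorff and \<open>S\<close> is dense in it, disjoint open sets \<open>A\<close>, \<open>B\<close> enlarge to the sets
  \<open>int (A \<union> (S~ - S))\<close>, \<open>int (B \<union> (S~ - S))\<close>, which are essential and still disjoint. If \<open>f x \<noteq> g x\<close>, take such
  neighbourhoods \<open>U\<close>, \<open>V\<close> of \<open>f x\<close>, \<open>g x\<close>; by regularity some open \<open>W \<ni> x\<close> has its closure inside
  the preimages of \<open>U\<close> under \<open>f\<close> and of \<open>V\<close> under \<open>g\<close>, and the essential closed set
  \<open>K = cl (W \<inter> S)\<close> contains \<open>x\<close>, so the sets \<open>O\<^bsub>K,U\<^esub>\<close> and \<open>O\<^bsub>K,V\<^esub>\<close> separate \<open>f\<close> from \<open>g\<close>.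
  For the space of affine maps on \<open>S\<close> it remains to see that \<open>f \<mapsto> f~\<close> is injective, for which the
  extensions must be shown to exist and to be unique.
\<close>

section \<open>Separation in the modified compact-open topology\<close>

text \<open>The operation taking \<open>A\<close> to the interior of \<open>A\<close> together with
  the complement of \<open>E\<close> is idempotent: its result adds to \<open>A\<close> only points
  outside \<open>E\<close>, so adjoining that complement a second time yields nothing new.\<close>

lemma essential_open_interior_of_Un:
  assumes "A \<subseteq> topspace Y"
  shows "essential_open Y E (Y interior_of (A \<union> (topspace Y - E)))" (is "essential_open Y E ?U")
proof -
  have "?U \<union> (topspace Y - E) \<subseteq> A \<union> (topspace Y - E)"
    using interior_of_subset by fastforce
  then have "Y interior_of (?U \<union> (topspace Y - E)) \<subseteq> ?U"
    by (rule interior_of_mono)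
  moreover have "?U \<subseteq> Y interior_of (?U \<union> (topspace Y - E))"
    by (intro interior_of_maximal) auto
  ultimately show ?thesis
    by (auto simp: essential_open_def)
qed

text \<open>Dual to the previous lemma. The closure of \<open>W \<inter> D\<close> already contains
  \<open>W \<inter> D\<close> within its trace on \<open>D\<close>, so closing that trace gives back
  the whole set.\<close>

lemma essential_closed_closure_of_Int:
  assumes "D \<subseteq> topspace X" "W \<subseteq> topspace X"
  shows "essential_closed X D (X closure_of (W \<inter> D))"
proof -
  have "W \<inter> D \<subseteq> X closure_of (W \<inter> D) \<inter> D"
    using assms closure_of_subset[of "W \<inter> D" X] by blast
  then have "X closure_of (W \<inter> D) \<subseteq> X closure_of (X closure_of (W \<inter> D) \<inter> D)"
    by (rule closure_of_mono)
  moreover have "X closure_of (X closure_of (W \<inter> D) \<inter> D) \<subseteq> X closure_of (W \<inter> D)"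
    by (intro closure_of_minimal) auto
  ultimately show ?thesis
    by (auto simp: essential_closed_def)
qed

text \<open>A point of \<open>E\<close> in an enlarged set lies in the original one. Hence the
  enlargements of disjoint \<open>A\<close> and \<open>B\<close> have an open intersection that
  misses \<open>E\<close>, and such a set is empty because \<open>E\<close> is dense.\<close>

lemma essential_open_separation:
  assumes "Hausdorff_space Y" "Y closure_of E = topspace Y"
    and "a \<in> topspace Y" "b \<in> topspace Y" "a \<noteq> b"
  obtains U V where "essential_open Y E U" "essential_open Y E V" "a \<in> U" "b \<in> V" "disjnt U V"
proof -
  obtain A B where AB: "openin Y A" "openin Y B" "a \<in> A" "b \<in> B" "disjnt A B"
    using assms unfolding Hausdorff_space_def by metis
  let ?I = "\<lambda>A. Y interior_of (A \<union> (topspace Y - E))"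
  have sub: "A \<subseteq> ?I A" "B \<subseteq> ?I B"
    using AB by (intro interior_of_maximal; blast)+
  have "openin Y (?I A \<inter> ?I B)"
    by auto
  moreover have "(?I A \<inter> ?I B) \<inter> E = {}"
    using AB interior_of_subset[of Y] unfolding disjnt_iff by blast
  ultimately have "?I A \<inter> ?I B \<inter> Y closure_of E = {}"
    by (simp add: openin_Int_closure_of_eq_empty)
  moreover have "?I A \<subseteq> topspace Y"
    by (rule interior_of_subset_topspace)
  ultimately have "disjnt (?I A) (?I B)"
    using assms(2) by (auto simp: disjnt_def)
  with AB sub show ?thesis
    using that essential_open_interior_of_Un openin_subset by (metis subsetD)
qed

lemma Hausdorff_space_cmaps_topology:
  assumes X: "regular_space X" and D: "D \<subseteq> topspace X" "X closure_of D = topspace X"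
    and Y: "Hausdorff_space Y" "Y closure_of E = topspace Y"
  shows "Hausdorff_space (cmaps_topology X D Y E)"
  unfolding Hausdorff_space_def topspace_cmaps_topology
proof clarify
  fix f g assume fg: "f \<in> cmaps X Y" "g \<in> cmaps X Y" "f \<noteq> g"
  then have cont: "continuous_map X Y f" "continuous_map X Y g"
    by (auto simp: cmaps_def)
  obtain x where x: "x \<in> topspace X" "f x \<noteq> g x"
    using fg by (auto simp: cmaps_def) (meson extensionalityI)
  obtain U V where UV: "essential_open Y E U" "essential_open Y E V"
      "f x \<in> U" "g x \<in> V" "disjnt U V"
    using essential_open_separation[OF Y, of "f x" "g x"] x cont
    by (metis continuous_map_image_subset_topspace image_subset_iff)
  define N where "N = {z \<in> topspace X. f z \<in> U} \<inter> {z \<in> topspace X. g z \<in> V}"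
  have "openin X N"
    using UV cont unfolding N_def essential_open_def
    by (intro openin_Int openin_continuous_map_preimage) auto
  moreover have "x \<in> N"
    using x UV by (simp add: N_def)
  ultimately obtain W C where WC: "openin X W" "closedin X C" "x \<in> W" "W \<subseteq> C" "C \<subseteq> N"
    using X unfolding neighbourhood_base_of_closedin[symmetric] neighbourhood_base_of
    by metis
  define K where "K = X closure_of (W \<inter> D)"
  have K: "essential_closed X D K"
    unfolding K_def using openin_subset[OF WC(1)] by (intro essential_closed_closure_of_Int D) auto
  have "K \<subseteq> N"
    using closure_of_minimal[of "W \<inter> D" C X] WC by (auto simp: K_def)
  then have fK: "f ` K \<subseteq> U" and gK: "g ` K \<subseteq> V"
    by (auto simp: N_def)
  \<comment> \<open>For open \<open>W\<close> the set \<open>W \<inter> X closure_of D\<close> lies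
    in the closure of \<open>W \<inter> D\<close>, and \<open>D\<close> is dense.\<close>
  have "x \<in> K"
    using WC x D openin_Int_closure_of_subset[of X W D] by (auto simp: K_def)
  let ?O = "\<lambda>U. {f \<in> cmaps X Y. f ` K \<subseteq> U}"
  have open_O: "openin (cmaps_topology X D Y E) (?O U)" if "essential_open Y E U" for U
    unfolding cmaps_topology_def using K that
    by (intro topology_generated_by_Basis) blast
  \<comment> \<open>A common member would map \<open>x\<close> into both \<open>U\<close> and
    \<open>V\<close>; this needs a point in \<open>K\<close>.\<close>
  have "disjnt (?O U) (?O V)"
    using \<open>x \<in> K\<close> UV(5) by (auto simp: disjnt_iff image_subset_iff)
  then show "\<exists>U V. openin (cmaps_topology X D Y E) U \<and> openin (cmaps_topology X D Y E) V \<and>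
      f \<in> U \<and> g \<in> V \<and> disjnt U V"
    using open_O UV fg fK gK by blast
qed

lemma Hausdorff_space_pullback_topology:
  assumes T: "Hausdorff_space T" and inj: "inj_on f A"
  shows "Hausdorff_space (pullback_topology A f T)"
  unfolding Hausdorff_space_def
proof (intro allI impI)
  fix x y
  assume xy: "x \<in> topspace (pullback_topology A f T) \<and> y \<in> topspace (pullback_topology A f T) \<and> x \<noteq> y"
  then have "f x \<noteq> f y" "f x \<in> topspace T" "f y \<in> topspace T" "x \<in> A" "y \<in> A"
    using inj by (auto simp: topspace_pullback_topology inj_on_def)
  then obtain U V where "openin T U" "openin T V" "f x \<in> U" "f y \<in> V" "disjnt U V"
    using T unfolding Hausdorff_space_def by metis
  then show "\<exists>U V. openin (pullback_topology A f T) U \<and> openin (pullback_topology A f T) V \<and>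
      x \<in> U \<and> y \<in> V \<and> disjnt U V"
    using \<open>x \<in> A\<close> \<open>y \<in> A\<close>
    by (intro exI[of _ "f -` U \<inter> A"] exI[of _ "f -` V \<inter> A"])
       (auto simp: openin_pullback_topology disjnt_iff)
qed


section \<open>Linear parts of affine functionals\<close>

text \<open>An affine hull that is a subspace is its own direction space, so its vectors are
  multiples \<open>a *\<^sub>R (x - y)\<close> of differences of points of \<open>C\<close>.
  Linearity forces the value \<open>a * (h x - h y)\<close>; the work lies in showing that this is
  well defined and additive.\<close>

lemma affine_functional_linear_part:
  fixes C :: "'a::real_vector set" and h :: "'a \<Rightarrow> real"
  assumes C: "convex C" and h: "affine_map_on C h" and V: "subspace (affine hull C)"
  obtains L where "linear_functional_on (affine hull C) L"
    "\<And>x y. x \<in> C \<Longrightarrow> y \<in> C \<Longrightarrow> L (x - y) = h x - h y"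
proof -
  \<comment> \<open>The graph of \<open>L\<close>, first treated as a relation because
    single-valuedness is proved only after closure under sums and multiples. Taking \<open>a\<close>
    nonnegative allows sums to be formed by convex combinations; a negative factor is absorbed by
    exchanging \<open>x\<close> and \<open>y\<close>.\<close>
  define P where "P v r \<longleftrightarrow> (\<exists>a x y. 0 \<le> a \<and> x \<in> C \<and> y \<in> C \<and>
      v = a *\<^sub>R (x - y) \<and> r = a * (h x - h y))" for v r
  have "C \<noteq> {}"
    using V subspace_0 by fastforce
  then obtain x0 where x0: "x0 \<in> C" by blast
  have P0: "P 0 0"
    unfolding P_def using x0 by (intro exI[of _ 0] exI[of _ x0]) auto
  have comb: "(1 - t) *\<^sub>R x + t *\<^sub>R y \<in> C"
      "h ((1 - t) *\<^sub>R x + t *\<^sub>R y) = (1 - t) * h x + t * h y"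
    if "x \<in> C" "y \<in> C" "0 \<le> t" "t \<le> 1" for x y t
    using C h that by (auto simp: convex_alt affine_map_on_def)
  have P_add: "P (v + w) (r + s)" if vr: "P v r" and ws: "P w s" for v w r s
  proof -
    obtain a x y where a: "0 \<le> a" "x \<in> C" "y \<in> C" "v = a *\<^sub>R (x - y)" "r = a * (h x - h y)"
      using vr unfolding P_def by blast
    obtain b x' y' where b: "0 \<le> b" "x' \<in> C" "y' \<in> C" "w = b *\<^sub>R (x' - y')" "s = b * (h x' - h y')"
      using ws unfolding P_def by blast
    show ?thesis
    proof (cases "a + b = 0")
      case True
      then have "a = 0" "b = 0" using a b by linarith+
      then show ?thesis using P0 a b by simp
    next
      case False
      \<comment> \<open>The weight that merges the two differences into one: \<open>a\<close> times
        the first plus \<open>b\<close> times the second is \<open>a + b\<close> times the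
        difference of two convex combinations.\<close>
      define t where "t = b / (a + b)"
      have t: "0 \<le> t" "t \<le> 1" "(a + b) * t = b" "(a + b) * (1 - t) = a"
        using a b False by (auto simp: t_def field_simps)
      let ?z = "(1 - t) *\<^sub>R x + t *\<^sub>R x'" and ?z' = "(1 - t) *\<^sub>R y + t *\<^sub>R y'"
      have "v + w = ((a + b) * (1 - t)) *\<^sub>R (x - y) + ((a + b) * t) *\<^sub>R (x' - y')"
        using a b t by simp
      also have "\<dots> = (a + b) *\<^sub>R (?z - ?z')"
        by (simp only: scaleR_scaleR[symmetric] scaleR_right_diff_distrib scaleR_right_distrib)
           (simp add: algebra_simps)
      finally have "v + w = (a + b) *\<^sub>R (?z - ?z')" .
      moreover have "r + s = (a + b) * (h ?z - h ?z')"
      proof -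
        have "r + s = ((a + b) * (1 - t)) * (h x - h y) + ((a + b) * t) * (h x' - h y')"
          using a b t by simp
        also have "\<dots> = (a + b) * (((1 - t) * h x + t * h x') - ((1 - t) * h y + t * h y'))"
          by (simp add: algebra_simps)
        also have "\<dots> = (a + b) * (h ?z - h ?z')"
          using comb(2) a(2,3) b(2,3) t(1,2) by simp
        finally show ?thesis .
      qed
      moreover have "?z \<in> C" "?z' \<in> C" "0 \<le> a + b"
        using comb a b t by auto
      ultimately show ?thesis
        unfolding P_def by blast
    qed
  qed
  have P_scale: "P (c *\<^sub>R v) (c * r)" if vr: "P v r" for c v r
  proof -
    obtain a x y where a: "0 \<le> a" "x \<in> C" "y \<in> C" "v = a *\<^sub>R (x - y)" "r = a * (h x - h y)"
      using vr unfolding P_def by blast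
    show ?thesis
    proof (cases "0 \<le> c")
      case True
      then show ?thesis
        unfolding P_def using a by (intro exI[of _ "c * a"] exI[of _ x] exI[of _ y]) auto
    next
      case False
      have "c *\<^sub>R v = (- c * a) *\<^sub>R (y - x)" "c * r = (- c * a) * (h y - h x)"
        unfolding a(4,5) by (simp_all add: algebra_simps)
      moreover have "0 \<le> - c * a"
        using False a(1) by (simp add: mult_nonpos_nonneg)
      ultimately show ?thesis
        unfolding P_def using a(2,3) by blast
    qed
  qed
  \<comment> \<open>A zero vector means \<open>a = 0\<close> or \<open>x = y\<close>, and either
    gives value 0. Uniqueness at any \<open>v\<close> follows by subtracting two values.\<close>
  have P_0: "r = 0" if "P 0 r" for r
    using that unfolding P_def by auto
  have P_unique: "r = s" if "P v r" "P v s" for v r s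
    using P_0[of "r - s"] P_add[OF that(1) P_scale[OF that(2), of "-1"]] by simp
  have P_ex: "\<exists>r. P v r" if v: "v \<in> affine hull C" for v
  proof -
    have sub: "subspace {v. \<exists>r. P v r}"
      unfolding subspace_def using P0 P_add P_scale by blast
    have Pdiff: "P (- x0 + x) (h x - h x0)" if "x \<in> C" for x
      unfolding P_def using that x0 by (intro exI[of _ 1] exI[of _ x] exI[of _ x0]) auto
    have span: "span ((+) (- x0) ` C) \<subseteq> {v. \<exists>r. P v r}"
      by (intro span_minimal sub) (use Pdiff in blast)
    have hull: "affine hull C = (+) x0 ` span ((+) (- x0) ` C)"
      using affine_hull_span_gen[of x0 C] hull_inc[OF x0] by metis
    have "0 \<in> affine hull C"
      using V by (rule subspace_0)
    \<comment> \<open>Since the hull is \<open>x0\<close> plus this span, containing 0 puts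
      \<open>x0\<close> itself, and then every vector of the hull, into the domain of
      \<open>P\<close>.\<close>
    then have "- x0 \<in> span ((+) (- x0) ` C)"
      unfolding hull by (auto simp: add_eq_0_iff2 add_eq_0_iff)
    then obtain r where "P x0 r"
      using span P_scale[of "- x0" _ "-1"] by auto
    moreover obtain w where "w \<in> span ((+) (- x0) ` C)" "v = x0 + w"
      using v unfolding hull by auto
    ultimately show ?thesis
      using span P_add by blast
  qed
  define L where "L v = (THE r. P v r)" for v
  have L: "L v = r" if "P v r" for v r
    unfolding L_def using that P_unique by blast
  show thesis
  proof
    show "linear_functional_on (affine hull C) L"
      unfolding linear_functional_on_def
      using P_ex L P_add P_scale by metis
    show "L (x - y) = h x - h y" if "x \<in> C" "y \<in> C" for x y
      by (rule L) (unfold P_def, use that in \<open>intro exI[of _ 1] exI[of _ x] exI[of _ y], auto\<close>)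
  qed
qed


section \<open>Extension of affine maps to the compactification\<close>

lemma linear_functional_on_diff:
  assumes "linear_functional_on V f" "subspace V" "x \<in> V" "y \<in> V"
  shows "f (x - y) = f x - f y"
proof -
  have "f (x + (-1) *\<^sub>R y) = f x + (-1) * f y"
    using assms unfolding linear_functional_on_def by (metis subspace_scale)
  then show ?thesis by simp
qed

lemma continuous_map_tvs_diff:
  assumes "topological_vector_space T"
  shows "continuous_map (prod_topology T T) T (\<lambda>(x, y). x - y)"
proof -
  have add: "continuous_map (prod_topology T T) T (\<lambda>(x, y). x + y)"
    and scale: "continuous_map (prod_topology euclideanreal T) T (\<lambda>(c, x). c *\<^sub>R x)"
    using assms by (auto simp: topological_vector_space_def)
  have "continuous_map (prod_topology T T) (prod_topology euclideanreal T) (\<lambda>p. (-1, snd p))"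
    by (intro continuous_map_pairedI continuous_map_snd) auto
  from continuous_map_compose[OF this scale]
  have "continuous_map (prod_topology T T) T (\<lambda>p. - snd p)"
    by (simp add: o_def)
  then have "continuous_map (prod_topology T T) (prod_topology T T) (\<lambda>p. (fst p, - snd p))"
    by (intro continuous_map_pairedI continuous_map_fst)
  from continuous_map_compose[OF this add] show ?thesis
    by (simp add: o_def case_prod_unfold)
qed

lemma continuous_map_tvs_convex_combination:
  assumes T: "topological_vector_space T" and "continuous_map X T f" "continuous_map X T g"
  shows "continuous_map X T (\<lambda>x. (1 - u) *\<^sub>R f x + u *\<^sub>R g x)"
proof -
  have add: "continuous_map (prod_topology T T) T (\<lambda>(x, y). x + y)"
    and scale: "continuous_map (prod_topology euclideanreal T) T (\<lambda>(c, x). c *\<^sub>R x)"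
    using T by (auto simp: topological_vector_space_def)
  have "continuous_map X T (\<lambda>x. c *\<^sub>R f x)" if "continuous_map X T f" for c f
  proof -
    have "continuous_map X (prod_topology euclideanreal T) (\<lambda>x. (c, f x))"
      using that by (intro continuous_map_pairedI) auto
    from continuous_map_compose[OF this scale] show ?thesis
      by (simp add: o_def)
  qed
  then have "continuous_map X (prod_topology T T) (\<lambda>x. ((1 - u) *\<^sub>R f x, u *\<^sub>R g x))"
    using assms by (intro continuous_map_pairedI) auto
  from continuous_map_compose[OF this add] show ?thesis
    by (simp add: o_def)
qed

text \<open>For fixed \<open>u\<close> both sides of the affine identity are continuous in the pair
  \<open>(x, y)\<close> and agree on the dense set \<open>C \<times> C\<close>, hence everywhere,
  the target being Hausdorff.\<close>

lemma affine_map_on_closure_of: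
  assumes T: "topological_vector_space T" and T': "topological_vector_space T'" "Hausdorff_space T'"
    and C: "C \<subseteq> topspace T" "convex (T closure_of C)"
    and cont: "continuous_map (subtopology T (T closure_of C)) T' g"
    and aff: "affine_map_on C g" and "convex C"
  shows "affine_map_on (T closure_of C) g"
  unfolding affine_map_on_def
proof (intro ballI)
  fix x y and u :: real
  assume xy: "x \<in> T closure_of C" "y \<in> T closure_of C" and u: "u \<in> {0..1}"
  let ?X = "subtopology T (T closure_of C)"
  have CX: "C \<subseteq> T closure_of C"
    using C by (simp add: closure_of_subset)
  have X: "topspace ?X = T closure_of C"
    using closure_of_subset_topspace[of T C] by auto
  have "?X closure_of C = T closure_of C"
    using CX by (simp add: closure_of_subtopology Int_absorb1)
  then have mem: "(x, y) \<in> prod_topology ?X ?X closure_of (C \<times> C)"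
    using xy by (simp add: closure_of_Times)
  have fst: "continuous_map (prod_topology ?X ?X) ?X fst"
    and snd: "continuous_map (prod_topology ?X ?X) ?X snd"
    by (auto intro: continuous_map_fst continuous_map_snd)
  have "continuous_map (prod_topology ?X ?X) T (\<lambda>p. (1 - u) *\<^sub>R fst p + u *\<^sub>R snd p)"
    using fst snd
    by (intro continuous_map_tvs_convex_combination T) (auto simp: continuous_map_in_subtopology)
  \<comment> \<open>Convexity of the closure keeps the combination inside the domain on which
    \<open>g\<close> is continuous.\<close>
  moreover have "(1 - u) *\<^sub>R a + u *\<^sub>R b \<in> T closure_of C"
    if "a \<in> T closure_of C" "b \<in> T closure_of C" for a b
    using C(2) u that by (auto simp: convex_alt)
  ultimately have "continuous_map (prod_topology ?X ?X) ?X (\<lambda>p. (1 - u) *\<^sub>R fst p + u *\<^sub>R snd p)"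
    using X by (auto simp: continuous_map_in_subtopology)
  from continuous_map_compose[OF this cont]
  have 1: "continuous_map (prod_topology ?X ?X) T' (\<lambda>p. g ((1 - u) *\<^sub>R fst p + u *\<^sub>R snd p))"
    by (simp add: o_def)
  have 2: "continuous_map (prod_topology ?X ?X) T' (\<lambda>p. (1 - u) *\<^sub>R g (fst p) + u *\<^sub>R g (snd p))"
    using continuous_map_compose[OF fst cont] continuous_map_compose[OF snd cont]
    by (intro continuous_map_tvs_convex_combination T'(1)) (auto simp: o_def)
  show "g ((1 - u) *\<^sub>R x + u *\<^sub>R y) = (1 - u) *\<^sub>R g x + u *\<^sub>R g y"
    using forall_in_closure_of_eq[OF mem T'(2) 1 2] aff u
    by (auto simp: affine_map_on_def)
qed

lemma affine_map_on_convex_image: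
  assumes "convex S" "affine_map_on S f"
  shows "convex (f ` S)"
  unfolding convex_alt
proof clarify
  fix x y and u :: real
  assume *: "x \<in> S" "y \<in> S" "0 \<le> u" "u \<le> 1"
  then have "(1 - u) *\<^sub>R f x + u *\<^sub>R f y = f ((1 - u) *\<^sub>R x + u *\<^sub>R y)"
    using assms(2) by (auto simp: affine_map_on_def)
  moreover have "(1 - u) *\<^sub>R x + u *\<^sub>R y \<in> S"
    using assms(1) * by (auto simp: convex_alt)
  ultimately show "(1 - u) *\<^sub>R f x + u *\<^sub>R f y \<in> f ` S"
    by auto
qed

section \<open>The compactification as a space, and extension by completeness\<close>

context convex_compactification
begin

lemma image_subset_topspace: "\<iota> ` S \<subseteq> topspace T"
  using small_subset hull_subset[of "\<iota> ` S" affine] by blast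

lemma image_subset_closure: "\<iota> ` S \<subseteq> T closure_of (\<iota> ` S)"
  by (simp add: closure_of_subset image_subset_topspace)

lemma topspace_ctop: "topspace (ctop S \<iota> T) = T closure_of (\<iota> ` S)"
  using closure_of_subset_topspace[of T "\<iota> ` S"] by (auto simp: ctop_def)

lemma closure_of_ctop: "ctop S \<iota> T closure_of (\<iota> ` S) = topspace (ctop S \<iota> T)"
  unfolding topspace_ctop using image_subset_closure
  by (simp add: ctop_def closure_of_subtopology Int_absorb1)

lemma tvs: "topological_vector_space T" and Hausdorff: "Hausdorff_space T"
  using tvs_big by (auto simp: locally_convex_Hausdorff_tvs_def)

lemma Hausdorff_ctop: "Hausdorff_space (ctop S \<iota> T)"
  unfolding ctop_def by (intro Hausdorff_space_subtopology Hausdorff)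

lemma regular_ctop: "regular_space (ctop S \<iota> T)"
  using closure_compact Hausdorff_ctop
  by (intro compact_Hausdorff_imp_regular_space) (auto simp: ctop_def compact_space_subtopology)

text \<open>On the image of \<open>S\<close> the linear part differs from \<open>h\<close> by a
  constant, so it is bounded there. It is then one of the functionals that generate the topology of
  V(S), hence continuous.\<close>

lemma bounded_affine_functional_linear_part:
  assumes S: "convex S" and h: "affine_map_on (\<iota> ` S) h" "bounded (h ` \<iota> ` S)"
  obtains L where "linear_functional_on (affine hull (\<iota> ` S)) L"
    "continuous_map (subtopology T (affine hull (\<iota> ` S))) euclideanreal L"
    "\<And>x y. x \<in> \<iota> ` S \<Longrightarrow> y \<in> \<iota> ` S \<Longrightarrow> L (x - y) = h x - h y"
proof -
  let ?V = "affine hull (\<iota> ` S)"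
  obtain L where L: "linear_functional_on ?V L"
    "\<And>x y. x \<in> \<iota> ` S \<Longrightarrow> y \<in> \<iota> ` S \<Longrightarrow> L (x - y) = h x - h y"
    using affine_functional_linear_part[OF affine_map_on_convex_image[OF S embedding_affine] h(1)
      small_subspace] by metis
  have sub: "\<iota> ` S \<subseteq> ?V"
    by (rule hull_subset)
  have bdd: "bounded (L ` \<iota> ` S)"
  proof (cases "S = {}")
    case False
    then obtain x0 where x0: "x0 \<in> \<iota> ` S" by blast
    have "L x = L x0 + (h x - h x0)" if "x \<in> \<iota> ` S" for x
      using linear_functional_on_diff[OF L(1) small_subspace, of x x0] L(2)[OF that x0]
        subsetD[OF sub that] subsetD[OF sub x0] by simp
    then have "L x = (L x0 - h x0) + h x" if "x \<in> \<iota> ` S" for x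
      using that by force
    then have "L ` \<iota> ` S = (\<lambda>r. (L x0 - h x0) + r) ` (h ` \<iota> ` S)"
      by (simp add: image_image)
    then show ?thesis
      using bounded_translation[OF h(2)] by simp
  qed auto
  have "continuous_map (weak_topology ?V {f. linear_functional_on ?V f \<and> bounded (f ` \<iota> ` S)})
      euclideanreal L"
  proof (unfold continuous_map, intro conjI allI impI)
    fix U :: "real set" assume "openin euclideanreal U"
    then show "openin (weak_topology ?V {f. linear_functional_on ?V f \<and> bounded (f ` \<iota> ` S)})
        {x \<in> topspace (weak_topology ?V {f. linear_functional_on ?V f \<and> bounded (f ` \<iota> ` S)}).
          L x \<in> U}"
      using L(1) bdd unfolding weak_topology_def topology_generated_by_topspace
      by (intro topology_generated_by_Basis) auto
  qed auto
  then show ?thesis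
    using that L unfolding small_topology[symmetric] by blast
qed

text \<open>
  The map \<open>\<phi>\<close> is uniformly continuous: its composition with a continuous linear functional is a
  bounded affine functional, whose linear part is continuous on \<open>V(S)\<close>. Hence \<open>\<phi>\<close> maps the
  neighbourhood filter of each point of \<open>S~\<close> to a Cauchy filter, which has a limit in \<open>K\<close>.
\<close>

lemma affine_map_extension:
  fixes T' :: "'w::real_vector topology"
  assumes S: "convex S" and aff: "affine_map_on (\<iota> ` S) \<phi>" and K: "\<phi> ` \<iota> ` S \<subseteq> K"
    and T': "topological_vector_space T'" "Hausdorff_space T'"
    and weak: "T' = weak_topology (topspace T')
        {f. linear_functional_on (topspace T') f \<and> continuous_map T' euclideanreal f}"
    and comp: "compactin T' K" "complete_in T' K"
  obtains g where "continuous_map (ctop S \<iota> T) (subtopology T' K) g"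
    "affine_map_on (topspace (ctop S \<iota> T)) g" "\<And>x. x \<in> \<iota> ` S \<Longrightarrow> g x = \<phi> x"
proof -
  let ?C = "\<iota> ` S"
  let ?V = "affine hull ?C"
  let ?F = "{f. linear_functional_on (topspace T') f \<and> continuous_map T' euclideanreal f}"
  have KT: "K \<subseteq> topspace T'"
    using comp(1) by (rule compactin_subset_topspace)
  have CT: "?C \<subseteq> topspace T" and CV: "?C \<subseteq> ?V"
    by (rule image_subset_topspace hull_subset)+
  have subT': "subspace (topspace T')"
    using T' by (simp add: topological_vector_space_def)
  have part: "\<exists>L. linear_functional_on ?V L \<and> continuous_map (subtopology T ?V) euclideanreal L \<and>
      (\<forall>x\<in>?C. \<forall>y\<in>?C. L (x - y) = l (\<phi> x) - l (\<phi> y))" if l: "l \<in> ?F" for l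
  proof -
    \<comment> \<open>Compactness of \<open>K\<close> is what makes \<open>l \<circ> \<phi>\<close>
      bounded.\<close>
    have "compactin euclideanreal (l ` K)"
      using l comp(1) by (intro image_compactin) auto
    then have "bounded (l ` K)"
      by (simp add: compact_imp_bounded)
    then have "bounded ((l \<circ> \<phi>) ` ?C)"
      by (rule bounded_subset) (use K in auto)
    moreover have "affine_map_on ?C (l \<circ> \<phi>)"
      unfolding affine_map_on_def
    proof (intro ballI)
      fix x y and u :: real assume *: "x \<in> ?C" "y \<in> ?C" "u \<in> {0..1}"
      then have "\<phi> x \<in> topspace T'" "\<phi> y \<in> topspace T'"
        using K KT by blast+
      then have "l ((1 - u) *\<^sub>R \<phi> x + u *\<^sub>R \<phi> y) = (1 - u) * l (\<phi> x) + u * l (\<phi> y)"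
        using l subT' by (simp add: linear_functional_on_def subspace_scale)
      then show "(l \<circ> \<phi>) ((1 - u) *\<^sub>R x + u *\<^sub>R y) = (1 - u) *\<^sub>R (l \<circ> \<phi>) x + u *\<^sub>R (l \<circ> \<phi>) y"
        using aff[unfolded affine_map_on_def, rule_format, OF *] by simp
    qed
    ultimately show ?thesis
      using bounded_affine_functional_linear_part[OF S, of "l \<circ> \<phi>"] by (metis comp_apply)
  qed
  have contC: "continuous_map (subtopology T ?C) euclideanreal (\<lambda>x. l (\<phi> x))" if l: "l \<in> ?F" for l
  proof (cases "?C = {}")
    case False
    then obtain x0 where x0: "x0 \<in> ?C" by blast
    obtain L where L: "linear_functional_on ?V L"
        "continuous_map (subtopology T ?V) euclideanreal L"
        "\<forall>x\<in>?C. \<forall>y\<in>?C. L (x - y) = l (\<phi> x) - l (\<phi> y)"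
      using part[OF l] by blast
    have "continuous_map (subtopology T ?C) euclideanreal L"
      using L(2) CV continuous_map_from_subtopology_mono by blast
    \<comment> \<open>The added constant is the one for which the sum equals
      \<open>l (\<phi> x)\<close> at \<open>x0\<close>, and therefore on all of
      \<open>?C\<close>.\<close>
    then have "continuous_map (subtopology T ?C) euclideanreal (\<lambda>x. L x + (l (\<phi> x0) - L x0))"
      by (intro continuous_map_add) auto
    moreover have "L x + (l (\<phi> x0) - L x0) = l (\<phi> x)" if "x \<in> ?C" for x
      using linear_functional_on_diff[OF L(1) small_subspace, of x x0]
          L(3)[rule_format, OF that x0] subsetD[OF CV that] subsetD[OF CV x0] by simp
    ultimately show ?thesis
      by (rule continuous_map_eq) auto
  qed (simp add: continuous_map_on_empty2)
  have cont: "continuous_map (subtopology T ?C) T' \<phi>"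
  proof -
    have "continuous_map (subtopology T ?C) (weak_topology (topspace T') ?F) \<phi>"
      unfolding weak_topology_def
    proof (rule continuous_on_generated_topo)
      fix U assume "U \<in> insert (topspace T') {{x \<in> topspace T'. f x \<in> U} |f U. f \<in> ?F \<and> open U}"
      then consider "U = topspace T'"
        | l O' where "l \<in> ?F" "open O'" "U = {x \<in> topspace T'. l x \<in> O'}"
        by auto
      then show "openin (subtopology T ?C) (\<phi> -` U \<inter> topspace (subtopology T ?C))"
      proof cases
        case 1
        then have "\<phi> -` U \<inter> topspace (subtopology T ?C) = topspace (subtopology T ?C)"
          using K KT by auto
        then show ?thesis by (metis openin_topspace)
      next
        case 2
        have "openin (subtopology T ?C) {x \<in> topspace (subtopology T ?C). l (\<phi> x) \<in> O'}"
          using openin_continuous_map_preimage[OF contC[OF 2(1)]] 2(2) by simp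
        also have "{x \<in> topspace (subtopology T ?C). l (\<phi> x) \<in> O'} =
            \<phi> -` U \<inter> topspace (subtopology T ?C)"
          using K KT 2(3) by auto
        finally show ?thesis .
      qed
    qed (use K KT in auto)
    then show ?thesis
      by (subst weak)
  qed
  \<comment> \<open>Small oscillation of \<open>\<phi>\<close> near every point of the big space,
    not only near points of S. The induction follows the generation of \<open>U\<close> from the
    subbase; for a union, one member containing 0 suffices.\<close>
  have small: "\<exists>A. openin T A \<and> x \<in> A \<and> (\<forall>a\<in>A\<inter>?C. \<forall>b\<in>A\<inter>?C. \<phi> a - \<phi> b \<in> U)"
    if "openin T' U" "0 \<in> U" and x: "x \<in> topspace T" for U x
  proof -
    have "generate_topology_on
        (insert (topspace T') {{x \<in> topspace T'. f x \<in> U} |f U. f \<in> ?F \<and> open U}) U"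
      using \<open>openin T' U\<close> weak unfolding weak_topology_def
      by (metis (no_types, lifting) openin_topology_generated_by)
    then show ?thesis
      using \<open>0 \<in> U\<close>
    proof induction
      case (Int U1 U2)
      then obtain A1 A2 where "openin T A1 \<and> x \<in> A1 \<and> (\<forall>a\<in>A1\<inter>?C. \<forall>b\<in>A1\<inter>?C. \<phi> a - \<phi> b \<in> U1)"
        "openin T A2 \<and> x \<in> A2 \<and> (\<forall>a\<in>A2\<inter>?C. \<forall>b\<in>A2\<inter>?C. \<phi> a - \<phi> b \<in> U2)"
        by (metis Int_iff)
      then show ?case
        by (intro exI[of _ "A1 \<inter> A2"]) auto
    next
      case (UN \<K>)
      then obtain k where k: "k \<in> \<K>" "0 \<in> k"
        by blast
      then obtain A where "openin T A \<and> x \<in> A \<and> (\<forall>a\<in>A\<inter>?C. \<forall>b\<in>A\<inter>?C. \<phi> a - \<phi> b \<in> k)"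
        using UN.IH[of k] by blast
      then show ?case
        using k(1) by (intro exI[of _ A]) blast
    next
      case (Basis B)
      have diff: "\<phi> a - \<phi> b \<in> topspace T'" if "a \<in> ?C" "b \<in> ?C" for a b
        using that K KT subT' by (intro subspace_diff) blast+
      consider "B = topspace T'" | l O' where "l \<in> ?F" "open O'" "B = {x \<in> topspace T'. l x \<in> O'}"
        using Basis(1) by auto
      then show ?case
      proof cases
        case 1
        then show ?thesis
          using diff x by (intro exI[of _ "topspace T"]) auto
      next
        case 2
        obtain L where L: "linear_functional_on ?V L"
            "continuous_map (subtopology T ?V) euclideanreal L"
            "\<forall>x\<in>?C. \<forall>y\<in>?C. L (x - y) = l (\<phi> x) - l (\<phi> y)"
          using part[OF 2(1)] by blast
        have zero: "l 0 = 0" "L 0 = 0"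
          using linear_functional_on_diff[of "topspace T'" l 0 0] 2(1) subspace_0[OF subT']
            linear_functional_on_diff[of ?V L 0 0] L(1) small_subspace subspace_0[OF small_subspace]
            subT' by auto
        have "openin (subtopology T ?V) {v \<in> topspace (subtopology T ?V). L v \<in> O'}"
          using openin_continuous_map_preimage[OF L(2)] 2(2) by simp
        \<comment> \<open>Since \<open>x\<close> may lie outside V(S), the neighbourhood of 0 in
          V(S) is first extended to an open \<open>W\<close> of \<open>T\<close>. Continuity of
          subtraction at \<open>(x, x)\<close> then gives neighbourhoods of \<open>x\<close> whose
          differences lie in \<open>W\<close>.\<close>
        then obtain W where W: "openin T W" "{v \<in> topspace (subtopology T ?V). L v \<in> O'} = W \<inter> ?V"
          by (auto simp: openin_subtopology)
        have "0 \<in> {v \<in> topspace (subtopology T ?V). L v \<in> O'}"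
          using Basis(2) 2(3) zero small_subset subspace_0[OF small_subspace] by auto
        then have "0 \<in> W"
          using W(2) by blast
        moreover have "openin (prod_topology T T)
            {p \<in> topspace (prod_topology T T). (\<lambda>(x, y). x - y) p \<in> W}"
          using openin_continuous_map_preimage[OF continuous_map_tvs_diff[OF tvs] W(1)] .
        ultimately obtain A1 A2 where A: "openin T A1" "openin T A2" "x \<in> A1" "x \<in> A2"
          "A1 \<times> A2 \<subseteq> {p \<in> topspace (prod_topology T T). (\<lambda>(x, y). x - y) p \<in> W}"
          using x unfolding openin_prod_topology_alt
          by (elim allE[of _ x], elim allE[of _ x]) auto
        have "\<phi> a - \<phi> b \<in> B" if ab: "a \<in> A1 \<inter> A2 \<inter> ?C" "b \<in> A1 \<inter> A2 \<inter> ?C" for a b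
        proof -
          have "a - b \<in> W"
            using ab A(5) by auto
          moreover have "a - b \<in> ?V"
            using ab CV small_subspace by (intro subspace_diff) auto
          ultimately have "L (a - b) \<in> O'"
            using W(2) by blast
          moreover have "L (a - b) = l (\<phi> a - \<phi> b)"
          proof -
            have "\<phi> a \<in> topspace T'" "\<phi> b \<in> topspace T'"
              using ab K KT by blast+
            then have "l (\<phi> a - \<phi> b) = l (\<phi> a) - l (\<phi> b)"
              using 2(1) subT' by (intro linear_functional_on_diff[of "topspace T'"]) auto
            moreover have "L (a - b) = l (\<phi> a) - l (\<phi> b)"
              using L(3) ab by blast
            ultimately show ?thesis by simp
          qed
          ultimately show ?thesis
            using 2(3) diff ab by auto
        qed
        then show ?thesis
          using A by (intro exI[of _ "A1 \<inter> A2"]) auto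
      qed
    qed auto
  qed
  have lim: "\<exists>l. limitin (subtopology T' K) \<phi> l (atin_within T x ?C)"
    if x: "x \<in> T closure_of ?C - ?C" for x
  proof -
    let ?N = "atin_within T x ?C"
    have xT: "x \<in> topspace T"
      using x closure_of_subset_topspace[of T ?C] by blast
    \<comment> \<open>The filter \<open>?N\<close> ignores \<open>x\<close> itself; as
      \<open>x\<close> is in the closure of \<open>?C\<close> but not in \<open>?C\<close>, every
      neighbourhood still meets \<open>?C\<close> in another point.\<close>
    have "filtermap \<phi> ?N \<noteq> bot"
      unfolding filtermap_bot_iff
    proof
      assume "?N = bot"
      then have "eventually (\<lambda>_. False) ?N" by simp
      then obtain O' where O': "openin T O'" "x \<in> O'" "\<forall>y\<in>O'. \<not> (y \<in> ?C \<and> y \<noteq> x)"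
        using xT unfolding eventually_atin_within by auto
      moreover obtain y where "y \<in> ?C" "y \<in> O'"
        using DiffD1[OF x] O'(1,2) unfolding in_closure_of by meson
      ultimately show False
        using x by (metis DiffD2)
    qed
    moreover have evK: "eventually (\<lambda>a. \<phi> a \<in> K) ?N"
      unfolding eventually_atin_within using xT K by blast
    then have "eventually (\<lambda>y. y \<in> K) (filtermap \<phi> ?N)"
      by (simp add: eventually_filtermap)
    moreover have "cauchy_filter_in T' (filtermap \<phi> ?N)"
      unfolding cauchy_filter_in_def
    proof (intro allI impI)
      fix U assume "openin T' U \<and> 0 \<in> U"
      then obtain A where A: "openin T A" "x \<in> A" "\<forall>a\<in>A\<inter>?C. \<forall>b\<in>A\<inter>?C. \<phi> a - \<phi> b \<in> U"
        using small xT by metis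
      then have "eventually (\<lambda>a. \<phi> a \<in> \<phi> ` (A \<inter> ?C)) ?N"
        unfolding eventually_atin_within by blast
      then show "\<exists>A. eventually (\<lambda>y. y \<in> A) (filtermap \<phi> ?N) \<and> (\<forall>y\<in>A. \<forall>z\<in>A. y - z \<in> U)"
        using A by (intro exI[of _ "\<phi> ` (A \<inter> ?C)"]) (auto simp: eventually_filtermap)
    qed
    ultimately obtain l where "l \<in> K" "limitin T' (\<lambda>x. x) l (filtermap \<phi> ?N)"
      using comp(2) unfolding complete_in_def by blast
    moreover from this have "limitin T' \<phi> l ?N"
      by (simp add: limitin_def eventually_filtermap)
    ultimately show ?thesis
      using evK unfolding limitin_subtopology by blast
  qed
  \<comment> \<open>Regularity of the target is what turns the limits at single points into one
    continuous extension.\<close>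
  have "regular_space (subtopology T' K)"
    using comp(1) T'(2)
    by (intro compact_Hausdorff_imp_regular_space Hausdorff_space_subtopology)
       (auto simp: compact_space_subtopology)
  moreover have "continuous_map (subtopology T ?C) (subtopology T' K) \<phi>"
    using cont K by (auto simp: continuous_map_in_subtopology)
  ultimately obtain g where
    g: "continuous_map (subtopology T (T closure_of ?C)) (subtopology T' K) g"
      "\<And>x. x \<in> ?C \<Longrightarrow> g x = \<phi> x"
    using continuous_map_extension_pointwise_alt[OF _ image_subset_closure subset_refl _ lim]
    by metis
  show thesis
  proof
    show "continuous_map (ctop S \<iota> T) (subtopology T' K) g"
      using g by (simp add: ctop_def)
    have conv: "convex ?C"
      using S embedding_affine by (rule affine_map_on_convex_image)
    then have "affine_map_on ?C g"
      using aff g(2) unfolding affine_map_on_def convex_alt by auto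
    then show "affine_map_on (topspace (ctop S \<iota> T)) g"
      unfolding topspace_ctop using g conv
      by (intro affine_map_on_closure_of[OF tvs T' CT closure_convex])
         (auto simp: continuous_map_in_subtopology)
  qed (use g in auto)
qed

end

section \<open>Injectivity of the passage from affine maps to their extensions\<close>

lemma affine_map_on_transfer:
  assumes S: "convex S" and f: "affine_map_on S f" "f ` S \<subseteq> S'" and \<iota>': "affine_map_on S' \<iota>'"
    and \<iota>: "affine_map_on S \<iota>" "inj_on \<iota> S"
  shows "affine_map_on (\<iota> ` S) (\<lambda>v. \<iota>' (f (inv_into S \<iota> v)))"
  unfolding affine_map_on_def
proof clarify
  fix x y and u :: real
  assume *: "x \<in> S" "y \<in> S" "u \<in> {0..1}"
  let ?z = "(1 - u) *\<^sub>R x + u *\<^sub>R y"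
  have z: "?z \<in> S"
    using S * by (auto simp: convex_alt)
  \<comment> \<open>The combination is the image of \<open>?z\<close>, so \<open>inv_into\<close>
    can be evaluated on it.\<close>
  have "(1 - u) *\<^sub>R \<iota> x + u *\<^sub>R \<iota> y = \<iota> ?z"
    using \<iota> * by (simp add: affine_map_on_def)
  then have "\<iota>' (f (inv_into S \<iota> ((1 - u) *\<^sub>R \<iota> x + u *\<^sub>R \<iota> y))) = \<iota>' (f ?z)"
    using \<iota> z by simp
  also have "\<dots> = (1 - u) *\<^sub>R \<iota>' (f x) + u *\<^sub>R \<iota>' (f y)"
    using f \<iota>' * by (auto simp: affine_map_on_def image_subset_iff)
  finally show "\<iota>' (f (inv_into S \<iota> ((1 - u) *\<^sub>R \<iota> x + u *\<^sub>R \<iota> y))) =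
      (1 - u) *\<^sub>R \<iota>' (f (inv_into S \<iota> (\<iota> x))) + u *\<^sub>R \<iota>' (f (inv_into S \<iota> (\<iota> y)))"
    using \<iota> * by simp
qed

text \<open>The description by \<open>THE\<close> denotes something only once existence and
  uniqueness hold. Existence comes from extending the transferred map; uniqueness from density of
  the image of \<open>S\<^sub>1\<close> and the Hausdorff target.\<close>

lemma affine_extension_eq:
  assumes S\<^sub>1: "convex S\<^sub>1"
    and cc1: "convex_compactification S\<^sub>1 \<iota>\<^sub>1 T\<^sub>1" and cc2: "convex_compactification S\<^sub>2 \<iota>\<^sub>2 T\<^sub>2"
    and f: "f \<in> affine_maps S\<^sub>1 S\<^sub>2" and s: "s \<in> S\<^sub>1"
  shows "affine_extension S\<^sub>1 \<iota>\<^sub>1 T\<^sub>1 S\<^sub>2 \<iota>\<^sub>2 T\<^sub>2 f (\<iota>\<^sub>1 s) = \<iota>\<^sub>2 (f s)"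
proof -
  interpret A: convex_compactification S\<^sub>1 \<iota>\<^sub>1 T\<^sub>1 by (rule cc1)
  interpret B: convex_compactification S\<^sub>2 \<iota>\<^sub>2 T\<^sub>2 by (rule cc2)
  let ?X = "ctop S\<^sub>1 \<iota>\<^sub>1 T\<^sub>1" and ?Y = "ctop S\<^sub>2 \<iota>\<^sub>2 T\<^sub>2"
  let ?Q = "\<lambda>g. g \<in> preserving_affine_maps ?X (\<iota>\<^sub>1 ` S\<^sub>1) ?Y (\<iota>\<^sub>2 ` S\<^sub>2) \<and> (\<forall>s\<in>S\<^sub>1. g (\<iota>\<^sub>1 s) = \<iota>\<^sub>2 (f s))"
  let ?\<phi> = "\<lambda>v. \<iota>\<^sub>2 (f (inv_into S\<^sub>1 \<iota>\<^sub>1 v))"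
  have fS: "f ` S\<^sub>1 \<subseteq> S\<^sub>2" "affine_map_on S\<^sub>1 f"
    using f by (auto simp: affine_maps_def)
  have \<phi>: "?\<phi> (\<iota>\<^sub>1 s) = \<iota>\<^sub>2 (f s)" if "s \<in> S\<^sub>1" for s
    using that A.embedding_inj by simp
  have "?\<phi> ` \<iota>\<^sub>1 ` S\<^sub>1 \<subseteq> T\<^sub>2 closure_of (\<iota>\<^sub>2 ` S\<^sub>2)"
    using \<phi> fS B.image_subset_closure by fastforce
  then obtain g where g: "continuous_map ?X ?Y g" "affine_map_on (topspace ?X) g"
      "\<And>x. x \<in> \<iota>\<^sub>1 ` S\<^sub>1 \<Longrightarrow> g x = ?\<phi> x"
    using A.affine_map_extension[OF S\<^sub>1 affine_map_on_transfer[OF S\<^sub>1 fS(2,1) B.embedding_affine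
        A.embedding_affine A.embedding_inj] _ B.tvs B.Hausdorff B.big_topology B.closure_compact
        B.closure_complete] unfolding ctop_def[of S\<^sub>2] by metis
  \<comment> \<open>Elements of \<open>cmaps\<close> are \<open>undefined\<close> off the carrier,
    so the extension has to be cut down.\<close>
  let ?g = "restrict g (topspace ?X)"
  have conv: "convex (topspace ?X)"
    using A.closure_convex by (simp add: A.topspace_ctop)
  have gS: "?g (\<iota>\<^sub>1 s) = \<iota>\<^sub>2 (f s)" if "s \<in> S\<^sub>1" for s
    using that g(3) \<phi> A.image_subset_closure by (auto simp: A.topspace_ctop)
  have "continuous_map ?X ?Y ?g"
    using g(1) by (rule continuous_map_eq) auto
  moreover have "affine_map_on (topspace ?X) ?g"
    using g(2) conv unfolding affine_map_on_def convex_alt by auto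
  moreover have "?g ` \<iota>\<^sub>1 ` S\<^sub>1 \<subseteq> \<iota>\<^sub>2 ` S\<^sub>2"
  proof clarify
    fix s assume "s \<in> S\<^sub>1"
    then show "?g (\<iota>\<^sub>1 s) \<in> \<iota>\<^sub>2 ` S\<^sub>2"
      using fS(1) by (simp only: gS) blast
  qed
  ultimately have ex: "?Q ?g"
    using gS by (auto simp: preserving_affine_maps_def continuous_affine_maps_def cmaps_def)
  have "k = ?g" if k: "?Q k" for k
  proof (rule extensionalityI)
    show "k \<in> extensional (topspace ?X)" "?g \<in> extensional (topspace ?X)"
      using k by (auto simp: preserving_affine_maps_def continuous_affine_maps_def cmaps_def)
    fix x assume "x \<in> topspace ?X"
    then have "x \<in> ?X closure_of (\<iota>\<^sub>1 ` S\<^sub>1)"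
      by (simp add: A.closure_of_ctop)
    then show "k x = ?g x"
    proof (rule forall_in_closure_of_eq[OF _ B.Hausdorff_ctop])
      show "continuous_map ?X ?Y k" "continuous_map ?X ?Y ?g"
        using k ex by (auto simp: preserving_affine_maps_def continuous_affine_maps_def cmaps_def)
      fix y assume "y \<in> \<iota>\<^sub>1 ` S\<^sub>1"
      then obtain s where s: "s \<in> S\<^sub>1" "y = \<iota>\<^sub>1 s"
        by blast
      then have "k y = \<iota>\<^sub>2 (f s)"
        using k by blast
      then show "k y = ?g y"
        by (simp only: s(2) gS[OF s(1)])
    qed
  qed
  then have "affine_extension S\<^sub>1 \<iota>\<^sub>1 T\<^sub>1 S\<^sub>2 \<iota>\<^sub>2 T\<^sub>2 f = ?g"
    unfolding affine_extension_def using ex by (intro the_equality)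
  then show ?thesis
    using gS s by simp
qed

text \<open>The values of an extension on the embedded \<open>S\<^sub>1\<close> determine
  \<open>\<iota>\<^sub>2 (f s)\<close>, and \<open>\<iota>\<^sub>2\<close> is injective.\<close>

lemma inj_on_affine_extension:
  assumes "convex S\<^sub>1"
    and "convex_compactification S\<^sub>1 \<iota>\<^sub>1 T\<^sub>1" and cc2: "convex_compactification S\<^sub>2 \<iota>\<^sub>2 T\<^sub>2"
  shows "inj_on (affine_extension S\<^sub>1 \<iota>\<^sub>1 T\<^sub>1 S\<^sub>2 \<iota>\<^sub>2 T\<^sub>2) (affine_maps S\<^sub>1 S\<^sub>2)"
proof (rule inj_onI)
  interpret B: convex_compactification S\<^sub>2 \<iota>\<^sub>2 T\<^sub>2 by (rule cc2)
  fix f g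
  assume fg: "f \<in> affine_maps S\<^sub>1 S\<^sub>2" "g \<in> affine_maps S\<^sub>1 S\<^sub>2"
    and eq: "affine_extension S\<^sub>1 \<iota>\<^sub>1 T\<^sub>1 S\<^sub>2 \<iota>\<^sub>2 T\<^sub>2 f = affine_extension S\<^sub>1 \<iota>\<^sub>1 T\<^sub>1 S\<^sub>2 \<iota>\<^sub>2 T\<^sub>2 g"
  have PiE: "f \<in> S\<^sub>1 \<rightarrow>\<^sub>E S\<^sub>2" "g \<in> S\<^sub>1 \<rightarrow>\<^sub>E S\<^sub>2"
    using fg by (auto simp: affine_maps_def)
  show "f = g"
  proof (rule PiE_ext[OF PiE])
    fix s assume s: "s \<in> S\<^sub>1"
    then have "\<iota>\<^sub>2 (f s) = \<iota>\<^sub>2 (g s)"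
      using affine_extension_eq[OF assms fg(1)] affine_extension_eq[OF assms fg(2)] eq by metis
    then show "f s = g s"
      using B.embedding_inj PiE s by (meson PiE_mem inj_onD)
  qed
qed

theorem proposition4:
  fixes S\<^sub>1 :: "'a::real_vector set" and \<iota>\<^sub>1 :: "'a \<Rightarrow> 'v::real_vector" and T\<^sub>1 :: "'v topology"
    and S\<^sub>2 :: "'b::real_vector set" and \<iota>\<^sub>2 :: "'b \<Rightarrow> 'w::real_vector" and T\<^sub>2 :: "'w topology"
  assumes "separated_convex_set S\<^sub>1" and "separated_convex_set S\<^sub>2"
    and "convex_compactification S\<^sub>1 \<iota>\<^sub>1 T\<^sub>1" and "convex_compactification S\<^sub>2 \<iota>\<^sub>2 T\<^sub>2"
  shows "Hausdorff_space
           (cmaps_topology (ctop S\<^sub>1 \<iota>\<^sub>1 T\<^sub>1) (\<iota>\<^sub>1 ` S\<^sub>1) (ctop S\<^sub>2 \<iota>\<^sub>2 T\<^sub>2) (\<iota>\<^sub>2 ` S\<^sub>2)) \<and>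
         Hausdorff_space
           (continuous_affine_maps_topology
              (ctop S\<^sub>1 \<iota>\<^sub>1 T\<^sub>1) (\<iota>\<^sub>1 ` S\<^sub>1) (ctop S\<^sub>2 \<iota>\<^sub>2 T\<^sub>2) (\<iota>\<^sub>2 ` S\<^sub>2)) \<and>
         Hausdorff_space (affine_maps_topology S\<^sub>1 \<iota>\<^sub>1 T\<^sub>1 S\<^sub>2 \<iota>\<^sub>2 T\<^sub>2)"
proof -
  interpret A: convex_compactification S\<^sub>1 \<iota>\<^sub>1 T\<^sub>1 by fact
  interpret B: convex_compactification S\<^sub>2 \<iota>\<^sub>2 T\<^sub>2 by fact
  have "convex S\<^sub>1"
    using assms(1) by (simp add: separated_convex_set_def)
  then have inj: "inj_on (affine_extension S\<^sub>1 \<iota>\<^sub>1 T\<^sub>1 S\<^sub>2 \<iota>\<^sub>2 T\<^sub>2) (affine_maps S\<^sub>1 S\<^sub>2)"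
    using assms(3,4) by (rule inj_on_affine_extension)
  have C: "Hausdorff_space (cmaps_topology (ctop S\<^sub>1 \<iota>\<^sub>1 T\<^sub>1) (\<iota>\<^sub>1 ` S\<^sub>1) (ctop S\<^sub>2 \<iota>\<^sub>2 T\<^sub>2) (\<iota>\<^sub>2 ` S\<^sub>2))"
    using A.image_subset_closure A.topspace_ctop
    by (intro Hausdorff_space_cmaps_topology A.regular_ctop A.closure_of_ctop B.Hausdorff_ctop
        B.closure_of_ctop) auto
  \<comment> \<open>The Hausdorff property passes to subspaces and to pullbacks along injective
    maps.\<close>
  show ?thesis
    unfolding continuous_affine_maps_topology_def affine_maps_topology_def
      preserving_affine_maps_topology_def
    by (intro conjI C Hausdorff_space_subtopology Hausdorff_space_pullback_topology inj)
qed

end
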